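(* Let $R=K[x_1,\dots,x_n]$ be a polynomial ring over a field $K$. An ideal $I\subset R$ is symmetric strongly shifted if and only if there is a strongly stable ideal $J\subset R$ such that $I$ is the symmetrization of $J$, i.e. $$I=\bigcap_{\sigma\in\mathfrak S_n}\sigma(J).$$ Moreover, under this symmetrization process the partition Borel generators of $I$ correspond to the Borel generators of $J$: if $I$ is symmetric strongly shifted with set of partition Borel generators $B(I)$, then the strongly stable ideal $J$ whose Borel generators are the monomials $x^\lambda$, $\lambda\in B(I)$, satisfies $I=\bigcap_{\sigma\in\mathfrak S_n}\sigma(J)$.
   Context: $\mathfrak S_n$ acts on $R$ by permuting variables. $P_n=\{\lambda\in\mathbb Z^n: 0\le\lambda_1\le\cdots\le\lambda_n\}$ is the set of partitions (written nondecreasingly), $x^\lambda=x_1^{\lambda_1}\cdots x_n^{\lambda_n}$. All ideals considered are proper. For an $\mathfrak S_n$-fixed monomial ideal $I$ put $P(I)=\{\lambda\in P_n: x^\lambda\in I\}$. An $\mathfrak S_n$-fixed monomial ideal $I$ is symmetric strongly shifted if for every $\lambda\in P(I)$ and $1\le i<j\le n$ with $\lambda_i<\lambda_j$ one has $x^\lambda x_i/x_j\in I$. A monomial ideal $J$ is strongly stable if for every monomial $x^\alpha\in J$ and every $i<j$ with $\alpha_j\neq0$ one has $x^\alpha x_i/x_j\in J$. For a set $M$ of monomials, $\mathrm{Borel}(M)$ is the smallest strongly stable ideal containing $M$; the Borel generators of a strongly stable ideal $J$ form the smallest set $M$ of monomials with $J=\mathrm{Borel}(M)$. For $B\subseteq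 P_n$, $\mathrm{Sss}(B)$ is the smallest symmetric strongly shifted ideal containing $\{x^\lambda:\lambda\in B\}$. For a symmetric strongly shifted ideal $I$, the set $B(I)$ of partition Borel generators is the smallest $B\subseteq P_n$ with $I=\mathrm{Sss}(B)$. *)

theory Defs
  imports
    Complex_Main
    "HOL-Library.Poly_Mapping"
    "HOL-Combinatorics.Permutations"
begin

text \<open>
  The polynomial ring \<open>R = K[x\<^sub>1, \<dots>, x\<^sub>n]\<close> is the monoid algebra of finitely supported functions
  from exponent vectors to coefficients. The variables are indexed by a finite linearly ordered
  type \<open>'n\<close>, whose cardinality is \<open>n\<close> and whose order is that of the variables.
\<close>

type_synonym ('n, 'k) mpoly = "('n \<Rightarrow>\<^sub>0 nat) \<Rightarrow>\<^sub>0 'k"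

definition mon :: "('n \<Rightarrow>\<^sub>0 nat) \<Rightarrow> ('n, 'k::field) mpoly" where
  "mon \<alpha> = Poly_Mapping.single \<alpha> 1"

text \<open>Exponent vector of \<open>x\<^sup>\<alpha> x\<^sub>i / x\<^sub>j\<close>. The subtraction is truncated, so this is meaningful only if
  \<open>i \<noteq> j\<close> and \<open>\<alpha>\<^sub>j \<noteq> 0\<close>.\<close>

definition shift :: "'n \<Rightarrow> 'n \<Rightarrow> ('n \<Rightarrow>\<^sub>0 nat) \<Rightarrow> ('n \<Rightarrow>\<^sub>0 nat)" where
  "shift i j \<alpha> = \<alpha> + Poly_Mapping.single i 1 - Poly_Mapping.single j 1"

text \<open>The algebra automorphism \<open>x\<^sub>i \<mapsto> x\<^bsub>\<sigma>(i)\<^esub>\<close>, on exponent vectors and on polynomials.\<close>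

definition perm_exp :: "('n \<Rightarrow> 'n) \<Rightarrow> ('n \<Rightarrow>\<^sub>0 nat) \<Rightarrow> ('n \<Rightarrow>\<^sub>0 nat)" where
  "perm_exp \<sigma> \<alpha> = (\<Sum>i\<in>Poly_Mapping.keys \<alpha>.
     Poly_Mapping.single (\<sigma> i) (Poly_Mapping.lookup \<alpha> i))"

definition perm_poly :: "('n \<Rightarrow> 'n) \<Rightarrow> ('n, 'k::field) mpoly \<Rightarrow> ('n, 'k) mpoly" where
  "perm_poly \<sigma> f = (\<Sum>\<alpha>\<in>Poly_Mapping.keys f.
     Poly_Mapping.single (perm_exp \<sigma> \<alpha>) (Poly_Mapping.lookup f \<alpha>))"

text \<open>Ideals of \<open>R\<close> are the submodules of \<open>R\<close> as a module over itself. Every ideal considered is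
  proper; in particular, properness is part of being a monomial ideal, hence also of being
  strongly stable or symmetric strongly shifted.\<close>

definition proper_ideal :: "('n, 'k::field) mpoly set \<Rightarrow> bool" where
  "proper_ideal I \<longleftrightarrow> module.subspace (*) I \<and> I \<noteq> UNIV"

definition monomial_ideal :: "('n, 'k::field) mpoly set \<Rightarrow> bool" where
  "monomial_ideal I \<longleftrightarrow> proper_ideal I \<and> (\<exists>M \<subseteq> range mon. I = module.span (*) M)"

definition sym_fixed :: "('n, 'k::field) mpoly set \<Rightarrow> bool" where
  "sym_fixed I \<longleftrightarrow> (\<forall>\<sigma>. \<sigma> permutes UNIV \<longrightarrow> perm_poly \<sigma> ` I = I)"

definition symmetrization :: "('n, 'k::field) mpoly set \<Rightarrow> ('n, 'k) mpoly set" where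
  "symmetrization J = (\<Inter>\<sigma>\<in>{\<sigma>. \<sigma> permutes UNIV}. perm_poly \<sigma> ` J)"

text \<open>Partitions are written in nondecreasing order.\<close>

definition partitions :: "('n::linorder \<Rightarrow>\<^sub>0 nat) set" where
  "partitions = {\<mu>. mono (Poly_Mapping.lookup \<mu>)}"

definition partitions_of :: "('n::linorder, 'k::field) mpoly set \<Rightarrow> ('n \<Rightarrow>\<^sub>0 nat) set" where
  "partitions_of I = {\<mu> \<in> partitions. mon \<mu> \<in> I}"

definition symmetric_strongly_shifted :: "('n::linorder, 'k::field) mpoly set \<Rightarrow> bool" where
  "symmetric_strongly_shifted I \<longleftrightarrow> monomial_ideal I \<and> sym_fixed I \<and>
     (\<forall>\<mu>\<in>partitions_of I. \<forall>i j. i < j \<longrightarrow>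
        Poly_Mapping.lookup \<mu> i < Poly_Mapping.lookup \<mu> j \<longrightarrow> mon (shift i j \<mu>) \<in> I)"

definition strongly_stable :: "('n::linorder, 'k::field) mpoly set \<Rightarrow> bool" where
  "strongly_stable J \<longleftrightarrow> monomial_ideal J \<and>
     (\<forall>\<alpha>. mon \<alpha> \<in> J \<longrightarrow> (\<forall>i j. i < j \<longrightarrow> Poly_Mapping.lookup \<alpha> j \<noteq> 0 \<longrightarrow> mon (shift i j \<alpha>) \<in> J))"

text \<open>Both classes of ideals are closed under nonempty intersections, so the hulls below are the
  smallest members containing the given monomials whenever some member contains them; otherwise
  the hull is all of \<open>R\<close>.\<close>

definition Borel :: "('n::linorder, 'k::field) mpoly set \<Rightarrow> ('n, 'k) mpoly set" where
  "Borel M = strongly_stable hull M"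

definition Sss :: "('n::linorder \<Rightarrow>\<^sub>0 nat) set \<Rightarrow> ('n, 'k::field) mpoly set" where
  "Sss B = symmetric_strongly_shifted hull (mon ` B)"

text \<open>``\<open>M\<close> is the set of (partition) Borel generators of the ideal'' is expressed as a relation, since
  the existence of a smallest generating set is not part of the definition.\<close>

definition borel_generators ::
  "('n::linorder, 'k::field) mpoly set \<Rightarrow> ('n, 'k) mpoly set \<Rightarrow> bool" where
  "borel_generators J M \<longleftrightarrow> M \<subseteq> range mon \<and> J = Borel M \<and>
     (\<forall>M'. M' \<subseteq> range mon \<and> J = Borel M' \<longrightarrow> M \<subseteq> M')"

definition partition_borel_generators ::
  "('n::linorder, 'k::field) mpoly set \<Rightarrow> ('n \<Rightarrow>\<^sub>0 nat) set \<Rightarrow> bool" where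
  "partition_borel_generators I B \<longleftrightarrow> B \<subseteq> partitions \<and> I = Sss B \<and>
     (\<forall>B'. B' \<subseteq> partitions \<and> I = Sss B' \<longrightarrow> B \<subseteq> B')"

end

theory Submission
  imports Defs
begin

text \<open>
  A monomial ideal is determined by its set of exponents. Order exponent vectors by comparing
  their prefix sums. The Borel closure of a set of monomials consists of the monomials whose
  exponent dominates one of the given exponents, and the same transfer argument shows that a
  symmetric strongly shifted ideal contains every partition dominating one of its partitions.
  Since a partition is dominated by all its rearrangements, both closures are governed by the
  same up-set of the dominance order, and both kinds of generators are its minimal elements.
\<close>

text \<open>The obstacle is that the shift condition of a symmetric strongly shifted ideal speaks
  only of partitions and of moves from a strictly larger entry to a smaller one, while a chain of
  unit moves from one partition to another may pass through vectors that are not sorted. Symmetry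
  carries the condition over to all exponents. Moreover \<open>dom_le_closure\<close> takes each
  unit from an index j where the current exponent \<beta> exceeds the target \<alpha> and gives it
  to an index i where \<beta> falls short. If the target is nondecreasing, then \<open>lk \<beta> i
  < lk \<alpha> i \<le> lk \<alpha> j < lk \<beta> j\<close>, so each move is permitted. For
  strongly stable ideals the same moves are permitted because \<open>lk \<beta> j\<close> is
  nonzero, so one lemma serves both classes.\<close>

abbreviation lk :: "('a \<Rightarrow>\<^sub>0 'b::zero) \<Rightarrow> 'a \<Rightarrow> 'b" where
  "lk \<equiv> Poly_Mapping.lookup"

section \<open>Monomial ideals and exponent sets\<close>

text \<open>Defined by supports rather than as a span, so that membership is checked on keys. It is
  an ideal exactly when the set is up-closed.\<close>

definition ideal_of :: "('n \<Rightarrow>\<^sub>0 nat) set \<Rightarrow> ('n, 'k::field) mpoly set" where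
  "ideal_of S = {f. Poly_Mapping.keys f \<subseteq> S}"

definition up_closed :: "('n \<Rightarrow>\<^sub>0 nat) set \<Rightarrow> bool" where
  "up_closed S \<longleftrightarrow> (\<forall>\<alpha>\<in>S. \<forall>\<beta>. \<alpha> + \<beta> \<in> S)"

definition exponents :: "('n, 'k::field) mpoly set \<Rightarrow> ('n \<Rightarrow>\<^sub>0 nat) set" where
  "exponents I = {\<alpha>. mon \<alpha> \<in> I}"

interpretation mpoly_module: module "(*) :: ('n, 'k::field) mpoly \<Rightarrow> _"
  by unfold_locales (simp_all add: algebra_simps)

lemma mon_in_ideal_of [simp]: "(mon \<alpha> :: ('n, 'k::field) mpoly) \<in> ideal_of S \<longleftrightarrow> \<alpha> \<in> S"
  by (simp add: mon_def ideal_of_def)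

lemma exponents_ideal_of [simp]: "exponents (ideal_of S :: ('n, 'k::field) mpoly set) = S"
  by (simp add: exponents_def)

lemma ideal_of_mono: "S \<subseteq> T \<Longrightarrow> ideal_of S \<subseteq> ideal_of T"
  by (auto simp: ideal_of_def)

lemma ideal_of_UNIV [simp]: "ideal_of UNIV = UNIV"
  by (simp add: ideal_of_def)

lemma subspace_ideal_of:
  assumes "up_closed S"
  shows "module.subspace (*) (ideal_of S :: ('n, 'k::field) mpoly set)"
proof (rule mpoly_module.subspaceI)
  show "0 \<in> (ideal_of S :: ('n, 'k) mpoly set)"
    by (simp add: ideal_of_def)
next
  fix f g :: "('n, 'k) mpoly"
  assume "f \<in> ideal_of S" "g \<in> ideal_of S"
  then show "f + g \<in> ideal_of S"
    using Poly_Mapping.keys_add[of f g] by (auto simp: ideal_of_def)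
next
  fix c f :: "('n, 'k) mpoly"
  assume "f \<in> ideal_of S"
  have "\<alpha> + \<beta> \<in> S" if "\<beta> \<in> Poly_Mapping.keys f" for \<alpha> \<beta>
    using that \<open>f \<in> ideal_of S\<close> assms
    by (subst add.commute) (auto simp: ideal_of_def up_closed_def)
  then show "c * f \<in> ideal_of S"
    using keys_mult[of c f] unfolding ideal_of_def by blast
qed

lemma sum_single_lookup:
  "(\<Sum>\<alpha>\<in>Poly_Mapping.keys f. Poly_Mapping.single \<alpha> (lk f \<alpha>)) = f"
  by (rule poly_mapping_eqI)
     (simp add: lookup_sum lookup_single when_def in_keys_iff)

text \<open>Every polynomial is the sum of its terms, each a constant times a monomial. The
  condition on 0 excludes the monomial 1 and so gives properness.\<close>

lemma monomial_ideal_ideal_of: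
  assumes "up_closed S" "0 \<notin> S"
  shows "monomial_ideal (ideal_of S :: ('n, 'k::field) mpoly set)"
proof -
  have "ideal_of S \<subseteq> module.span (*) (mon ` S :: ('n, 'k) mpoly set)"
  proof
    fix f :: "('n, 'k) mpoly"
    assume "f \<in> ideal_of S"
    then have "Poly_Mapping.single \<alpha> (lk f \<alpha>) \<in> module.span (*) (mon ` S)"
      if "\<alpha> \<in> Poly_Mapping.keys f" for \<alpha>
    proof -
      have "Poly_Mapping.single \<alpha> (lk f \<alpha>) = Poly_Mapping.single 0 (lk f \<alpha>) * mon \<alpha>"
        by (simp add: mon_def mult_single)
      moreover have "mon \<alpha> \<in> (mon ` S :: ('n, 'k) mpoly set)"
        using that \<open>f \<in> ideal_of S\<close> by (auto simp: ideal_of_def)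
      ultimately show ?thesis
        by (simp only: mpoly_module.span_scale mpoly_module.span_base)
    qed
    then have "(\<Sum>\<alpha>\<in>Poly_Mapping.keys f. Poly_Mapping.single \<alpha> (lk f \<alpha>))
        \<in> module.span (*) (mon ` S)"
      by (rule mpoly_module.span_sum)
    then show "f \<in> module.span (*) (mon ` S)"
      by (simp add: sum_single_lookup)
  qed
  moreover have "module.span (*) (mon ` S) \<subseteq> (ideal_of S :: ('n, 'k) mpoly set)"
    using assms(1) by (intro mpoly_module.span_minimal subspace_ideal_of) auto
  ultimately have "(ideal_of S :: ('n, 'k) mpoly set) = module.span (*) (mon ` S)"
    by blast
  moreover have "(ideal_of S :: ('n, 'k) mpoly set) \<noteq> UNIV"
    using assms(2) mon_in_ideal_of by blast
  ultimately show ?thesis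
    unfolding monomial_ideal_def proper_ideal_def
    using subspace_ideal_of[OF assms(1)] by (intro conjI exI[of _ "mon ` S"]) auto
qed

text \<open>Converse of \<open>monomial_ideal_ideal_of\<close>: together they let the rest of the
  argument take place on up-closed sets of exponents that omit 0.\<close>

lemma monomial_ideal_exponents:
  fixes I :: "('n, 'k::field) mpoly set"
  assumes "monomial_ideal I"
  shows "I = ideal_of (exponents I)" "up_closed (exponents I)" "0 \<notin> exponents I"
proof -
  obtain M where M: "M \<subseteq> range mon" "I = module.span (*) M"
    using assms by (auto simp: monomial_ideal_def)
  have sub: "module.subspace (*) I" and ne: "I \<noteq> UNIV"
    using assms by (auto simp: monomial_ideal_def proper_ideal_def)
  show up: "up_closed (exponents I)"
    unfolding up_closed_def exponents_def
  proof (intro ballI allI CollectI, drule CollectD)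
    fix \<alpha> \<beta> :: "'n \<Rightarrow>\<^sub>0 nat"
    assume "mon \<alpha> \<in> I"
    moreover have "mon (\<alpha> + \<beta>) = (mon \<beta> * mon \<alpha> :: ('n, 'k) mpoly)"
      by (simp add: mon_def mult_single add.commute)
    ultimately show "mon (\<alpha> + \<beta>) \<in> I"
      using mpoly_module.subspace_scale[OF sub] by simp
  qed
  have "M \<subseteq> ideal_of (exponents I)"
  proof
    fix m assume "m \<in> M"
    then obtain \<alpha> where "m = mon \<alpha>" "mon \<alpha> \<in> I"
      using M mpoly_module.span_base by blast
    then show "m \<in> ideal_of (exponents I)"
      by (simp add: exponents_def)
  qed
  then have "I \<subseteq> ideal_of (exponents I)"
    unfolding M(2)[symmetric] using subspace_ideal_of[OF up] M(2) mpoly_module.span_minimal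
    by blast
  moreover have "f \<in> I" if "f \<in> ideal_of (exponents I)" for f :: "('n, 'k) mpoly"
  proof -
    have "Poly_Mapping.single \<alpha> (lk f \<alpha>) \<in> I" if "\<alpha> \<in> Poly_Mapping.keys f" for \<alpha>
    proof -
      have "Poly_Mapping.single \<alpha> (lk f \<alpha>) = Poly_Mapping.single 0 (lk f \<alpha>) * mon \<alpha>"
        by (simp add: mon_def mult_single)
      moreover have "mon \<alpha> \<in> I"
        using that \<open>f \<in> ideal_of (exponents I)\<close> by (auto simp: ideal_of_def exponents_def)
      ultimately show ?thesis
        using mpoly_module.subspace_scale[OF sub] by simp
    qed
    then have "(\<Sum>\<alpha>\<in>Poly_Mapping.keys f. Poly_Mapping.single \<alpha> (lk f \<alpha>)) \<in> I"
      by (rule mpoly_module.subspace_sum[OF sub])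
    then show ?thesis
      by (simp add: sum_single_lookup)
  qed
  ultimately show "I = ideal_of (exponents I)"
    by blast
  show "0 \<notin> exponents I"
  proof
    assume "0 \<in> exponents I"
    then have "exponents I = UNIV"
      using up by (force simp: up_closed_def)
    then show False
      using ne \<open>I = ideal_of (exponents I)\<close> by simp
  qed
qed

section \<open>The action of permutations\<close>

text \<open>Pushforward along an injection. It serves twice: for \<open>perm_exp\<close> with g a
  permutation of the variables, and for \<open>perm_poly\<close> with g the induced map on
  exponents.\<close>

lemma lookup_sum_single_inj:
  assumes "inj g"
  shows "lk (\<Sum>a\<in>Poly_Mapping.keys f. Poly_Mapping.single (g a) (lk f a)) (g b) = lk f b"
proof -
  have "lk (\<Sum>a\<in>Poly_Mapping.keys f. Poly_Mapping.single (g a) (lk f a)) (g b) =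
      (\<Sum>a\<in>Poly_Mapping.keys f. if a = b then lk f a else 0)"
    unfolding lookup_sum
    by (intro sum.cong) (auto simp: lookup_single when_def inj_eq[OF assms])
  also have "\<dots> = lk f b"
    by (simp add: in_keys_iff)
  finally show ?thesis .
qed

lemma lookup_perm_exp:
  assumes "\<sigma> permutes UNIV"
  shows "lk (perm_exp \<sigma> \<alpha>) (\<sigma> i) = lk \<alpha> i"
  unfolding perm_exp_def by (rule lookup_sum_single_inj) (rule permutes_inj[OF assms])

lemma perm_exp_eqI:
  assumes "\<sigma> permutes UNIV" "\<And>i. lk \<beta> (\<sigma> i) = lk \<alpha> i"
  shows "perm_exp \<sigma> \<alpha> = \<beta>"
proof (rule poly_mapping_eqI)
  fix k
  obtain i where "k = \<sigma> i"
    using assms(1) by (metis permutes_surj surjD)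
  then show "lk (perm_exp \<sigma> \<alpha>) k = lk \<beta> k"
    by (simp add: lookup_perm_exp assms)
qed

lemma perm_exp_compose:
  assumes "\<sigma> permutes UNIV" "\<tau> permutes UNIV"
  shows "perm_exp \<sigma> (perm_exp \<tau> \<alpha>) = perm_exp (\<sigma> \<circ> \<tau>) \<alpha>"
proof (rule perm_exp_eqI[OF assms(1)])
  fix i
  obtain k where "i = \<tau> k"
    using assms(2) by (metis permutes_surj surjD)
  then show "lk (perm_exp (\<sigma> \<circ> \<tau>) \<alpha>) (\<sigma> i) = lk (perm_exp \<tau> \<alpha>) i"
    using lookup_perm_exp[OF permutes_compose[OF assms(2,1)], of \<alpha> k]
    by (simp add: lookup_perm_exp assms(2))
qed

lemma perm_exp_id [simp]: "perm_exp id \<alpha> = \<alpha>"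
  by (rule perm_exp_eqI) (auto simp: permutes_id)

lemma perm_exp_inv:
  assumes "\<sigma> permutes UNIV"
  shows "perm_exp (inv \<sigma>) (perm_exp \<sigma> \<alpha>) = \<alpha>" "perm_exp \<sigma> (perm_exp (inv \<sigma>) \<alpha>) = \<alpha>"
  using assms by (simp_all add: perm_exp_compose permutes_inv permutes_inv_o)

lemma inj_perm_exp: "\<sigma> permutes UNIV \<Longrightarrow> inj (perm_exp \<sigma>)"
  by (metis injI perm_exp_inv(1))

lemma perm_exp_add:
  assumes "\<sigma> permutes UNIV"
  shows "perm_exp \<sigma> (\<alpha> + \<beta>) = perm_exp \<sigma> \<alpha> + perm_exp \<sigma> \<beta>"
  using assms by (intro perm_exp_eqI) (simp_all add: lookup_add lookup_perm_exp)

lemma lookup_perm_poly: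
  assumes "\<sigma> permutes UNIV"
  shows "lk (perm_poly \<sigma> f) (perm_exp \<sigma> \<alpha>) = lk f \<alpha>"
  unfolding perm_poly_def by (rule lookup_sum_single_inj) (rule inj_perm_exp[OF assms])

lemma perm_poly_inv:
  assumes "\<sigma> permutes UNIV"
  shows "perm_poly \<sigma> (perm_poly (inv \<sigma>) f) = f"
proof (rule poly_mapping_eqI)
  fix \<alpha>
  have "lk (perm_poly \<sigma> (perm_poly (inv \<sigma>) f)) (perm_exp \<sigma> (perm_exp (inv \<sigma>) \<alpha>)) = lk f \<alpha>"
    using assms by (simp only: lookup_perm_poly permutes_inv)
  then show "lk (perm_poly \<sigma> (perm_poly (inv \<sigma>) f)) \<alpha> = lk f \<alpha>"
    by (simp add: perm_exp_inv assms)
qed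

lemma keys_perm_poly:
  assumes "\<sigma> permutes UNIV"
  shows "Poly_Mapping.keys (perm_poly \<sigma> f) = perm_exp \<sigma> ` Poly_Mapping.keys f"
proof -
  have "\<alpha> \<in> Poly_Mapping.keys (perm_poly \<sigma> f) \<longleftrightarrow> perm_exp (inv \<sigma>) \<alpha> \<in> Poly_Mapping.keys f" for \<alpha>
    using lookup_perm_poly[OF assms, of f "perm_exp (inv \<sigma>) \<alpha>"]
    by (simp add: perm_exp_inv assms in_keys_iff)
  then show ?thesis
    by (force simp: perm_exp_inv assms intro: image_eqI[of _ _ "perm_exp (inv \<sigma>) _"])
qed

lemma perm_poly_ideal_of:
  assumes "\<sigma> permutes UNIV"
  shows "perm_poly \<sigma> ` ideal_of S = (ideal_of (perm_exp \<sigma> ` S) :: ('n, 'k::field) mpoly set)"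
proof (intro equalityI subsetI)
  fix f :: "('n, 'k) mpoly"
  assume "f \<in> perm_poly \<sigma> ` ideal_of S"
  then show "f \<in> ideal_of (perm_exp \<sigma> ` S)"
    unfolding ideal_of_def using keys_perm_poly[OF assms] by blast
next
  fix f :: "('n, 'k) mpoly"
  assume "f \<in> ideal_of (perm_exp \<sigma> ` S)"
  then have "perm_exp (inv \<sigma>) \<alpha> \<in> S" if "\<alpha> \<in> Poly_Mapping.keys f" for \<alpha>
    using that perm_exp_inv(1)[OF assms] by (force simp: ideal_of_def)
  then have "perm_poly (inv \<sigma>) f \<in> ideal_of S"
    by (auto simp: ideal_of_def keys_perm_poly permutes_inv assms)
  then show "f \<in> perm_poly \<sigma> ` ideal_of S"
    using perm_poly_inv[OF assms, of f] by (metis imageI)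
qed

text \<open>The largest permutation-stable subset of S.\<close>

definition sym_core :: "('n \<Rightarrow>\<^sub>0 nat) set \<Rightarrow> ('n \<Rightarrow>\<^sub>0 nat) set" where
  "sym_core S = {\<alpha>. \<forall>\<sigma>. \<sigma> permutes UNIV \<longrightarrow> perm_exp \<sigma> \<alpha> \<in> S}"

text \<open>Lying in the image of S under every \<sigma> is the same as being sent into S by every
  \<sigma>, because \<sigma> and \<open>inv \<sigma>\<close> range over the same group.\<close>

lemma symmetrization_ideal_of:
  "symmetrization (ideal_of S) = (ideal_of (sym_core S) :: ('n, 'k::field) mpoly set)"
proof -
  have "(\<Inter>\<sigma>\<in>{\<sigma>. \<sigma> permutes UNIV}. perm_exp \<sigma> ` S) = sym_core S"
  proof (intro equalityI subsetI)
    fix \<alpha>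
    assume a: "\<alpha> \<in> (\<Inter>\<sigma>\<in>{\<sigma>. \<sigma> permutes UNIV}. perm_exp \<sigma> ` S)"
    show "\<alpha> \<in> sym_core S"
      unfolding sym_core_def
    proof (intro CollectI allI impI)
      fix \<sigma> :: "'n \<Rightarrow> 'n"
      assume s: "\<sigma> permutes UNIV"
      then obtain \<beta> where "\<beta> \<in> S" "\<alpha> = perm_exp (inv \<sigma>) \<beta>"
        using a permutes_inv[OF s] by blast
      then show "perm_exp \<sigma> \<alpha> \<in> S"
        by (simp add: perm_exp_inv s)
    qed
  next
    fix \<alpha>
    assume a: "\<alpha> \<in> sym_core S"
    show "\<alpha> \<in> (\<Inter>\<sigma>\<in>{\<sigma>. \<sigma> permutes UNIV}. perm_exp \<sigma> ` S)"
    proof (intro INT_I, drule CollectD)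
      fix \<sigma> :: "'n \<Rightarrow> 'n"
      assume s: "\<sigma> permutes UNIV"
      then have "perm_exp (inv \<sigma>) \<alpha> \<in> S"
        using a permutes_inv[OF s] by (simp add: sym_core_def)
      then show "\<alpha> \<in> perm_exp \<sigma> ` S"
        using perm_exp_inv(2)[OF s] by (metis imageI)
    qed
  qed
  moreover have "symmetrization (ideal_of S) =
      (ideal_of (\<Inter>\<sigma>\<in>{\<sigma>. \<sigma> permutes UNIV}. perm_exp \<sigma> ` S) :: ('n, 'k) mpoly set)"
    unfolding symmetrization_def by (auto simp: perm_poly_ideal_of) (auto simp: ideal_of_def)
  ultimately show ?thesis
    by simp
qed

lemma perm_exp_sym_core:
  assumes "\<alpha> \<in> sym_core S" "\<sigma> permutes UNIV"
  shows "perm_exp \<sigma> \<alpha> \<in> sym_core S"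
  using assms by (auto simp: sym_core_def perm_exp_compose permutes_compose)

lemma sym_fixed_ideal_of_sym_core:
  "sym_fixed (ideal_of (sym_core S) :: ('n, 'k::field) mpoly set)"
proof -
  have "perm_exp \<sigma> ` sym_core S = sym_core S" if s: "\<sigma> permutes UNIV" for \<sigma> :: "'n \<Rightarrow> 'n"
  proof
    show "perm_exp \<sigma> ` sym_core S \<subseteq> sym_core S"
      using perm_exp_sym_core s by blast
    show "sym_core S \<subseteq> perm_exp \<sigma> ` sym_core S"
      using perm_exp_sym_core[OF _ permutes_inv[OF s]] perm_exp_inv(2)[OF s]
      by (metis image_eqI subsetI)
  qed
  then show ?thesis
    by (simp add: sym_fixed_def perm_poly_ideal_of)
qed

lemma perm_exp_exponents:
  fixes I :: "('n, 'k::field) mpoly set"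
  assumes "monomial_ideal I" "sym_fixed I" "\<sigma> permutes UNIV" "\<alpha> \<in> exponents I"
  shows "perm_exp \<sigma> \<alpha> \<in> exponents I"
proof -
  have "perm_poly \<sigma> ` I = I"
    using assms(2,3) by (simp add: sym_fixed_def)
  then have "(ideal_of (perm_exp \<sigma> ` exponents I) :: ('n, 'k) mpoly set) = ideal_of (exponents I)"
    using monomial_ideal_exponents(1)[OF assms(1)] perm_poly_ideal_of[OF assms(3)] by metis
  then have "perm_exp \<sigma> ` exponents I = exponents I"
    by (metis exponents_ideal_of)
  then show ?thesis
    using assms(4) by blast
qed

section \<open>The dominance order\<close>

definition psum :: "('n::{finite,linorder} \<Rightarrow>\<^sub>0 nat) \<Rightarrow> 'n \<Rightarrow> nat" where
  "psum \<alpha> k = (\<Sum>i\<le>k. lk \<alpha> i)"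

text \<open>Dominance without equality of degrees, so that divisibility is a special case
  (\<open>dom_le_add\<close>). Moving a unit to an earlier variable goes up.\<close>

definition dom_le :: "('n::{finite,linorder} \<Rightarrow>\<^sub>0 nat) \<Rightarrow> ('n \<Rightarrow>\<^sub>0 nat) \<Rightarrow> bool" where
  "dom_le \<alpha> \<beta> \<longleftrightarrow> (\<forall>k. psum \<alpha> k \<le> psum \<beta> k)"

definition dom_up :: "('n::{finite,linorder} \<Rightarrow>\<^sub>0 nat) set \<Rightarrow> ('n \<Rightarrow>\<^sub>0 nat) set" where
  "dom_up A = {\<alpha>. \<exists>\<nu>\<in>A. dom_le \<nu> \<alpha>}"

lemma dom_le_refl [simp]: "dom_le \<alpha> \<alpha>"
  by (simp add: dom_le_def)

lemma dom_le_trans: "dom_le \<alpha> \<beta> \<Longrightarrow> dom_le \<beta> \<gamma> \<Longrightarrow> dom_le \<alpha> \<gamma>"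
  unfolding dom_le_def using le_trans by blast

lemma dom_up_refl: "\<alpha> \<in> A \<Longrightarrow> \<alpha> \<in> dom_up A"
  using dom_le_refl unfolding dom_up_def by blast

lemma dom_up_dom_le: "\<alpha> \<in> dom_up A \<Longrightarrow> dom_le \<alpha> \<beta> \<Longrightarrow> \<beta> \<in> dom_up A"
  unfolding dom_up_def using dom_le_trans by blast

lemma psum_split: "psum \<alpha> k = lk \<alpha> k + (\<Sum>i<k. lk \<alpha> i)"
proof -
  have "{..k} = insert k {..<k}"
    by auto
  then show ?thesis
    by (simp add: psum_def)
qed

lemma psum_eqD:
  assumes "\<And>k. psum \<alpha> k = psum \<beta> k"
  shows "\<alpha> = \<beta>"
proof (rule ccontr)
  assume "\<alpha> \<noteq> \<beta>"
  let ?D = "{k. lk \<alpha> k \<noteq> lk \<beta> k}"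
  have "?D \<noteq> {}"
    using \<open>\<alpha> \<noteq> \<beta>\<close> poly_mapping_eqI[of \<alpha> \<beta>] by auto
  define m where "m = Min ?D"
  have "m \<in> ?D"
    unfolding m_def using \<open>?D \<noteq> {}\<close> by (intro Min_in) auto
  have "lk \<alpha> i = lk \<beta> i" if "i < m" for i
    using that Min_le[of ?D i] unfolding m_def by fastforce
  then have "(\<Sum>i<m. lk \<alpha> i) = (\<Sum>i<m. lk \<beta> i)"
    by (intro sum.cong) auto
  then have "lk \<alpha> m = lk \<beta> m"
    using assms[of m] unfolding psum_split by linarith
  then show False
    using \<open>m \<in> ?D\<close> by simp
qed

text \<open>A natural number that grows strictly along dominance. The degree would not do, since
  unit moves preserve it. It yields antisymmetry, sorting by a least rearrangement, and descent to
  minimal elements.\<close>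

definition weight :: "('n::{finite,linorder} \<Rightarrow>\<^sub>0 nat) \<Rightarrow> nat" where
  "weight \<alpha> = (\<Sum>k\<in>UNIV. psum \<alpha> k)"

lemma dom_le_weight:
  assumes "dom_le \<alpha> \<beta>" "\<alpha> \<noteq> \<beta>"
  shows "weight \<alpha> < weight \<beta>"
proof -
  obtain k where "psum \<alpha> k < psum \<beta> k"
    using assms psum_eqD[of \<alpha> \<beta>] by (metis dom_le_def le_neq_implies_less)
  then show ?thesis
    using assms(1) unfolding weight_def dom_le_def
    by (intro sum_strict_mono_ex1) auto
qed

lemma dom_le_antisym: "dom_le \<alpha> \<beta> \<Longrightarrow> dom_le \<beta> \<alpha> \<Longrightarrow> \<alpha> = \<beta>"
  using dom_le_weight by (metis less_asym)

lemma dom_le_zero_iff: "dom_le \<alpha> 0 \<longleftrightarrow> \<alpha> = 0"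
  by (auto simp: dom_le_def psum_def intro!: psum_eqD)

lemma zero_dom_le [simp]: "dom_le 0 \<alpha>"
  by (simp add: dom_le_def psum_def)

lemma dom_le_add: "dom_le \<alpha> (\<alpha> + \<beta>)"
  by (simp add: dom_le_def psum_def lookup_add sum.distrib)

lemma up_closed_dom_up: "up_closed (dom_up A)"
  unfolding up_closed_def using dom_up_dom_le dom_le_add by blast

lemma zero_in_dom_up_iff: "0 \<in> dom_up A \<longleftrightarrow> 0 \<in> A"
  by (auto simp: dom_up_def dom_le_zero_iff)

lemma dom_up_eq_UNIV: "0 \<in> A \<Longrightarrow> dom_up A = UNIV"
  unfolding dom_up_def using zero_dom_le by blast

text \<open>Here \<beta> arises from \<alpha> by moving some amount from q to the earlier index p,
  and every prefix that contains q also contains p.\<close>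

lemma dom_le_transfer:
  assumes "p < q" "lk \<alpha> p \<le> lk \<beta> p" "lk \<alpha> p + lk \<alpha> q = lk \<beta> p + lk \<beta> q"
    and "\<And>k. k \<noteq> p \<Longrightarrow> k \<noteq> q \<Longrightarrow> lk \<alpha> k = lk \<beta> k"
  shows "dom_le \<alpha> \<beta>"
  unfolding dom_le_def
proof
  fix k
  define d where "d = lk \<beta> p - lk \<alpha> p"
  \<comment> \<open>Both sides are completed by d, at p and at q respectively, so that the identity
    needs no truncated subtraction.\<close>
  have "lk \<alpha> i + (if p = i then d else 0) = lk \<beta> i + (if q = i then d else 0)" for i
    using assms by (auto simp: d_def)
  then have "(\<Sum>i\<le>k. lk \<alpha> i + (if p = i then d else 0)) =
      (\<Sum>i\<le>k. lk \<beta> i + (if q = i then d else 0))"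
    by simp
  then show "psum \<alpha> k \<le> psum \<beta> k"
    using assms(1) by (auto simp: psum_def sum.distrib split: if_splits)
qed

lemma lookup_shift:
  "lk (shift i j \<alpha>) k = lk \<alpha> k + (if i = k then 1 else 0) - (if j = k then 1 else 0)"
  by (simp add: shift_def lookup_minus lookup_add lookup_single when_def)

text \<open>Stated additively because the subtraction is truncated; the hypotheses are those under
  which \<open>shift\<close> really moves a unit.\<close>

lemma psum_shift:
  assumes "i \<noteq> j" "lk \<alpha> j \<noteq> 0"
  shows "psum (shift i j \<alpha>) k + (if j \<le> k then 1 else 0) = psum \<alpha> k + (if i \<le> k then 1 else 0)"
proof -
  have "lk (shift i j \<alpha>) m + (if j = m then 1 else 0) = lk \<alpha> m + (if i = m then 1 else 0)" for m
    using assms by (auto simp: lookup_shift)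
  then have "(\<Sum>m\<le>k. lk (shift i j \<alpha>) m + (if j = m then 1 else 0)) =
      (\<Sum>m\<le>k. lk \<alpha> m + (if i = m then 1 else 0))"
    by simp
  then show ?thesis
    by (simp add: psum_def sum.distrib)
qed

lemma dom_le_shift:
  assumes "i < j" "lk \<alpha> j \<noteq> 0"
  shows "dom_le \<alpha> (shift i j \<alpha>)"
  using assms by (intro dom_le_transfer[of i j]) (auto simp: lookup_shift)

text \<open>
  Below, \<open>j\<close> is the first index at which \<open>\<nu>\<close> exceeds \<open>\<alpha>\<close>, so the prefix sums force an earlier
  index \<open>i\<close> at which it falls short; moving one unit from \<open>j\<close> to \<open>i\<close> keeps \<open>\<nu>\<close> below \<open>\<alpha>\<close>.
\<close>

lemma dom_le_closure:
  assumes up: "up_closed S" and "\<nu> \<in> S" "dom_le \<nu> \<alpha>"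
    and step: "\<And>\<beta> i j. \<beta> \<in> S \<Longrightarrow> i < j \<Longrightarrow> lk \<beta> i < lk \<alpha> i \<Longrightarrow> lk \<alpha> j < lk \<beta> j \<Longrightarrow>
      shift i j \<beta> \<in> S"
  shows "\<alpha> \<in> S"
  using \<open>\<nu> \<in> S\<close> \<open>dom_le \<nu> \<alpha>\<close>
\<comment> \<open>The measure is the total excess of \<nu> over \<alpha>; truncation ignores the
  indices where \<nu> falls short.\<close>
proof (induction "\<Sum>k\<in>UNIV. lk \<nu> k - lk \<alpha> k" arbitrary: \<nu> rule: less_induct)
  case less
  let ?D = "{j. lk \<alpha> j < lk \<nu> j}"
  show ?case
  proof (cases "?D = {}")
    case True
    \<comment> \<open>Without excess the subtraction is exact, so the target is a multiple of the
      current monomial. This absorbs any difference in degree.\<close>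
    then have "\<nu> + (\<alpha> - \<nu>) = \<alpha>"
      by (intro poly_mapping_eqI) (auto simp: lookup_add lookup_minus not_less)
    then show ?thesis
      using up less.prems(1) by (metis up_closed_def)
  next
    case False
    define j where "j = Min ?D"
    have j: "lk \<alpha> j < lk \<nu> j"
      using Min_in[of ?D] False by (simp add: j_def)
    have before: "lk \<nu> k \<le> lk \<alpha> k" if "k < j" for k
    proof (rule ccontr)
      assume "\<not> lk \<nu> k \<le> lk \<alpha> k"
      then have "j \<le> k"
        unfolding j_def by (intro Min_le) auto
      then show False
        using that by simp
    qed
    have psum: "psum \<nu> k \<le> psum \<alpha> k" for k
      using less.prems(2) by (simp add: dom_le_def)
    have "\<exists>i<j. lk \<nu> i < lk \<alpha> i"
    proof (rule ccontr)
      assume "\<not> (\<exists>i<j. lk \<nu> i < lk \<alpha> i)"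
      then have "lk \<nu> k = lk \<alpha> k" if "k < j" for k
        using that before[OF that] by (meson le_antisym not_le)
      then show False
        using psum[of j] j by (simp add: psum_split)
    qed
    then obtain i where i: "i < j" "lk \<nu> i < lk \<alpha> i"
      by blast
    define \<mu> where "\<mu> = shift i j \<nu>"
    \<comment> \<open>The move lowers the excess at j and creates none at i, where \<nu> was
      strictly below \<alpha>.\<close>
    have "(\<Sum>k\<in>UNIV. lk \<mu> k - lk \<alpha> k) < (\<Sum>k\<in>UNIV. lk \<nu> k - lk \<alpha> k)"
      using i j by (intro sum_strict_mono_ex1)
        (auto simp: \<mu>_def lookup_shift intro!: bexI[of _ j])
    moreover have "\<mu> \<in> S"
      using step[OF less.prems(1) i j] by (simp add: \<mu>_def)
    moreover have "dom_le \<mu> \<alpha>"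
      unfolding dom_le_def
    proof
      fix k
      have *: "psum \<mu> k + (if j \<le> k then 1 else 0) = psum \<nu> k + (if i \<le> k then 1 else 0)"
        using psum_shift[of i j \<nu> k] i j by (simp add: \<mu>_def)
      show "psum \<mu> k \<le> psum \<alpha> k"
      proof (cases "i \<le> k \<and> k < j")
        case True
        \<comment> \<open>Only these prefixes gain a unit. They end before j, so no entry of \<nu>
          in them exceeds that of \<alpha>, and the one at i is strictly smaller: there is room for
          the unit.\<close>
        then have "psum \<nu> k < psum \<alpha> k"
          unfolding psum_def using i before
          by (intro sum_strict_mono_ex1) (auto intro!: bexI[of _ i])
        then show ?thesis
          using * True by auto
      next
        case False
        then show ?thesis
          using * psum[of k] i(1) by (auto split: if_splits)
      qed
    qed
    ultimately show ?thesis
      using less.hyps by blast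
  qed
qed

section \<open>Partitions and rearrangements\<close>

text \<open>A prefix sum of the rearrangement is a sum of \<nu> over a set ?Q as large as the prefix
  ?P. The common part cancels; entries in ?P - ?Q are at most \<open>lk \<nu> k\<close>, entries in
  ?Q - ?P at least that, and both differences have the same size.\<close>

lemma partition_dom_le_perm_exp:
  assumes "\<nu> \<in> partitions" "\<sigma> permutes (UNIV :: 'n::{finite,linorder} set)"
  shows "dom_le \<nu> (perm_exp \<sigma> \<nu>)"
  unfolding dom_le_def
proof
  fix k :: 'n
  let ?P = "{..k}" and ?Q = "inv \<sigma> ` {..k}"
  have mono: "mono (lk \<nu>)"
    using assms(1) by (simp add: partitions_def)
  have inj: "inj (inv \<sigma>)"
    using assms(2) by (metis permutes_inj permutes_inv)
  have "psum (perm_exp \<sigma> \<nu>) k = (\<Sum>i\<le>k. lk \<nu> (inv \<sigma> i))"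
    unfolding psum_def
    using lookup_perm_exp[OF assms(2), of \<nu> "inv \<sigma> _"] assms(2)
    by (simp add: permutes_inverses)
  also have "\<dots> = sum (lk \<nu>) ?Q"
    using inj by (simp add: sum.reindex inj_on_subset)
  finally have Q: "psum (perm_exp \<sigma> \<nu>) k = sum (lk \<nu>) (?Q - ?P) + sum (lk \<nu>) (?P \<inter> ?Q)"
    using sum.Int_Diff[of ?Q "lk \<nu>" ?P] by (simp add: Int_commute)
  have P: "psum \<nu> k = sum (lk \<nu>) (?P - ?Q) + sum (lk \<nu>) (?P \<inter> ?Q)"
    using sum.Int_Diff[of ?P "lk \<nu>" ?Q] by (simp add: psum_def)
  have "card ?Q = card ?P"
    using inj by (simp add: card_image inj_on_subset)
  then have card: "card (?P - ?Q) = card (?Q - ?P)"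
    using card_Diff_subset_Int[of ?P ?Q] card_Diff_subset_Int[of ?Q ?P]
    by (simp add: Int_commute)
  have "sum (lk \<nu>) (?P - ?Q) \<le> card (?P - ?Q) * lk \<nu> k"
    using sum_bounded_above[of "?P - ?Q" "lk \<nu>" "lk \<nu> k"] mono by (auto simp: mono_def)
  also have "\<dots> = card (?Q - ?P) * lk \<nu> k"
    using card by simp
  also have "\<dots> \<le> sum (lk \<nu>) (?Q - ?P)"
    using sum_bounded_below[of "?Q - ?P" "lk \<nu> k" "lk \<nu>"] mono
    by (auto simp: mono_def not_le less_imp_le)
  finally show "psum \<nu> k \<le> psum (perm_exp \<sigma> \<nu>) k"
    using P Q by simp
qed

text \<open>A rearrangement of least weight is sorted, since exchanging an inversion lowers the weight.\<close>

lemma ex_perm_exp_partition: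
  fixes \<alpha> :: "'n::{finite,linorder} \<Rightarrow>\<^sub>0 nat"
  obtains \<sigma> where "\<sigma> permutes UNIV" "perm_exp \<sigma> \<alpha> \<in> partitions"
proof -
  obtain \<sigma> where s: "\<sigma> permutes (UNIV :: 'n set)"
    and least: "\<And>\<tau>. \<tau> permutes (UNIV :: 'n set) \<Longrightarrow>
      weight (perm_exp \<sigma> \<alpha>) \<le> weight (perm_exp \<tau> \<alpha>)"
    using ex_has_least_nat[of "\<lambda>\<sigma>. \<sigma> permutes (UNIV :: 'n set)" id "\<lambda>\<sigma>. weight (perm_exp \<sigma> \<alpha>)"]
      permutes_id by blast
  define \<beta> where "\<beta> = perm_exp \<sigma> \<alpha>"
  have "mono (lk \<beta>)"
  proof (rule ccontr)
    assume "\<not> mono (lk \<beta>)"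
    then obtain i j where "i \<le> j" "\<not> lk \<beta> i \<le> lk \<beta> j"
      by (auto simp: mono_def)
    then have ij: "i < j" "lk \<beta> j < lk \<beta> i"
      by (auto simp: order.strict_iff_order)
    define t where "t = transpose i j"
    have t: "t permutes UNIV"
      by (simp add: t_def permutes_swap_id)
    have l: "lk (perm_exp t \<beta>) k = lk \<beta> (transpose i j k)" for k
      using lookup_perm_exp[OF t, of \<beta> "t k"] by (simp add: t_def)
    \<comment> \<open>After the swap the smaller entry stands first, so \<beta> is recovered by
      moving units from j to the earlier i.\<close>
    have "dom_le (perm_exp t \<beta>) \<beta>"
      using ij by (intro dom_le_transfer[of i j]) (auto simp: l transpose_def)
    moreover have "perm_exp t \<beta> \<noteq> \<beta>"
      using ij l[of i] by auto
    ultimately have "weight (perm_exp (t \<circ> \<sigma>) \<alpha>) < weight \<beta>"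
      using dom_le_weight by (auto simp: \<beta>_def perm_exp_compose s t)
    then show False
      using least[of "t \<circ> \<sigma>"] s t by (simp add: permutes_compose \<beta>_def)
  qed
  then show ?thesis
    using that s by (auto simp: \<beta>_def partitions_def)
qed

text \<open>Symmetrization loses no partition of a dominance up-set. This is what makes the two
  kinds of generators correspond.\<close>

lemma partition_in_sym_core_dom_up:
  assumes "\<nu> \<in> partitions"
  shows "\<nu> \<in> sym_core (dom_up A) \<longleftrightarrow> \<nu> \<in> dom_up A"
proof
  assume "\<nu> \<in> sym_core (dom_up A)"
  then show "\<nu> \<in> dom_up A"
    using permutes_id perm_exp_id by (metis (mono_tags) mem_Collect_eq sym_core_def)
next
  assume "\<nu> \<in> dom_up A"
  then show "\<nu> \<in> sym_core (dom_up A)"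
    unfolding sym_core_def using assms partition_dom_le_perm_exp dom_up_dom_le by blast
qed

section \<open>Strongly stable and symmetric strongly shifted ideals\<close>

text \<open>Each move takes its unit from an index where \<beta> exceeds \<alpha>, hence from a
  nonzero entry, as strong stability requires.\<close>

lemma strongly_stable_dom_le:
  assumes "strongly_stable J" "\<nu> \<in> exponents J" "dom_le \<nu> \<alpha>"
  shows "\<alpha> \<in> exponents J"
proof (rule dom_le_closure[OF _ assms(2,3)])
  show "up_closed (exponents J)"
    using assms(1) monomial_ideal_exponents(2) by (auto simp: strongly_stable_def)
next
  fix \<beta> i j
  assume "\<beta> \<in> exponents J" "i < j" "lk \<alpha> j < lk \<beta> j"
  then show "shift i j \<beta> \<in> exponents J"
    using assms(1) by (auto simp: strongly_stable_def exponents_def)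
qed

lemma strongly_stable_ideal_of_dom_up:
  assumes "0 \<notin> A"
  shows "strongly_stable (ideal_of (dom_up A) :: ('n::{finite,linorder}, 'k::field) mpoly set)"
  unfolding strongly_stable_def
proof (intro conjI allI impI)
  show "monomial_ideal (ideal_of (dom_up A) :: ('n, 'k) mpoly set)"
    using assms by (simp add: monomial_ideal_ideal_of up_closed_dom_up zero_in_dom_up_iff)
next
  fix \<alpha> :: "'n \<Rightarrow>\<^sub>0 nat" and i j
  assume "(mon \<alpha> :: ('n, 'k) mpoly) \<in> ideal_of (dom_up A)" "i < j" "lk \<alpha> j \<noteq> 0"
  then show "(mon (shift i j \<alpha>) :: ('n, 'k) mpoly) \<in> ideal_of (dom_up A)"
    unfolding mon_in_ideal_of using dom_up_dom_le dom_le_shift by blast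
qed

lemma Borel_mon_image:
  "Borel (mon ` A) = (ideal_of (dom_up A) :: ('n::{finite,linorder}, 'k::field) mpoly set)"
proof
  show "Borel (mon ` A) \<subseteq> (ideal_of (dom_up A) :: ('n, 'k) mpoly set)"
  proof (cases "0 \<in> A")
    case True
    then show ?thesis
      \<comment> \<open>The generator 1 lies in no proper ideal, so the hull is all of R, in
        agreement with the up-set of 0.\<close>
      by (simp add: dom_up_eq_UNIV)
  next
    case False
    then show ?thesis
      unfolding Borel_def
      by (intro hull_minimal strongly_stable_ideal_of_dom_up) (auto intro: dom_up_refl)
  qed
  show "(ideal_of (dom_up A) :: ('n, 'k) mpoly set) \<subseteq> Borel (mon ` A)"
    unfolding Borel_def hull_def
  proof (rule Inter_greatest, clarify)
    fix J :: "('n, 'k) mpoly set" and f :: "('n, 'k) mpoly"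
    assume J: "strongly_stable J" "mon ` A \<subseteq> J" and f: "f \<in> ideal_of (dom_up A)"
    have "dom_up A \<subseteq> exponents J"
      using strongly_stable_dom_le[OF J(1)] J(2) by (auto simp: dom_up_def exponents_def)
    then have "f \<in> ideal_of (exponents J)"
      using f ideal_of_mono by blast
    then show "f \<in> J"
      using monomial_ideal_exponents(1) J(1) by (auto simp: strongly_stable_def)
  qed
qed

text \<open>Each rearrangement of the shifted exponent must lie in S. It dominates a suitable
  rearrangement of \<nu>, chosen according to whether \<sigma> keeps or reverses the order of i and
  j.\<close>

lemma symmetric_strongly_shifted_symmetrization:
  fixes J :: "('n::{finite,linorder}, 'k::field) mpoly set"
  assumes "strongly_stable J"
  shows "symmetric_strongly_shifted (symmetrization J)"
proof -
  define S where "S = exponents J"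
  have J: "J = ideal_of S" and up: "up_closed S" and "0 \<notin> S"
    using assms monomial_ideal_exponents[of J] by (auto simp: strongly_stable_def S_def)
  have closed: "\<gamma> \<in> S" if "\<beta> \<in> S" "dom_le \<beta> \<gamma>" for \<beta> \<gamma>
    using strongly_stable_dom_le[OF assms] that by (simp add: S_def)
  have "up_closed (sym_core S)"
    using up by (auto simp: up_closed_def sym_core_def perm_exp_add)
  moreover have "0 \<notin> sym_core S"
  proof
    assume "0 \<in> sym_core S"
    then have "perm_exp id 0 \<in> S"
      using permutes_id unfolding sym_core_def by blast
    then show False
      using \<open>0 \<notin> S\<close> by simp
  qed
  moreover have "shift i j \<nu> \<in> sym_core S"
    if l: "\<nu> \<in> sym_core S" "i < j" "lk \<nu> i < lk \<nu> j" for \<nu> i j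
    unfolding sym_core_def
  proof (intro CollectI allI impI)
    fix \<sigma> :: "'n \<Rightarrow> 'n"
    assume s: "\<sigma> permutes UNIV"
    define \<gamma> where "\<gamma> = perm_exp \<sigma> (shift i j \<nu>)"
    have ne: "\<sigma> i \<noteq> \<sigma> j"
      using s l(2) by (metis less_irrefl permutes_inj injD)
    have g: "lk \<gamma> (\<sigma> k) = lk \<nu> k + (if i = k then 1 else 0) - (if j = k then 1 else 0)" for k
      by (simp add: \<gamma>_def lookup_perm_exp s lookup_shift)
    show "\<gamma> \<in> S"
    proof (cases "\<sigma> i < \<sigma> j")
      case True
      define \<beta> where "\<beta> = perm_exp \<sigma> \<nu>"
      have b: "lk \<beta> (\<sigma> k) = lk \<nu> k" for k
        by (simp add: \<beta>_def lookup_perm_exp s)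
      have "lk \<beta> k = lk \<gamma> k" if "k \<noteq> \<sigma> i" "k \<noteq> \<sigma> j" for k
      proof -
        obtain m where "k = \<sigma> m"
          using s by (metis permutes_surj surjD)
        then show ?thesis
          using that g[of m] b[of m] by auto
      qed
      then have "dom_le \<beta> \<gamma>"
        using True l by (intro dom_le_transfer[of "\<sigma> i" "\<sigma> j"]) (auto simp: b g)
      moreover have "\<beta> \<in> S"
        using l(1) s by (simp add: \<beta>_def sym_core_def)
      ultimately show ?thesis
        using closed by blast
    next
      case False
      \<comment> \<open>Now \<sigma> sends j before i, and the shift moves a unit the wrong way.
        Swapping the two entries of \<nu> first puts \<open>lk \<nu> i\<close> at \<sigma> j, where
        \<gamma> has \<open>lk \<nu> j - 1\<close>; this is no smaller because
        \<open>lk \<nu> i < lk \<nu> j\<close>.\<close>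
      define t where "t = transpose i j"
      have t: "t permutes UNIV"
        by (simp add: t_def permutes_swap_id)
      define \<beta> where "\<beta> = perm_exp (\<sigma> \<circ> t) \<nu>"
      have b: "lk \<beta> (\<sigma> k) = lk \<nu> (t k)" for k
        using lookup_perm_exp[OF permutes_compose[OF t s], of \<nu> "t k"] by (simp add: \<beta>_def t_def)
      have "lk \<beta> k = lk \<gamma> k" if "k \<noteq> \<sigma> i" "k \<noteq> \<sigma> j" for k
      proof -
        obtain m where "k = \<sigma> m"
          using s by (metis permutes_surj surjD)
        then show ?thesis
          using that g[of m] b[of m] by (auto simp: t_def)
      qed
      then have "dom_le \<beta> \<gamma>"
        using False ne l by (intro dom_le_transfer[of "\<sigma> j" "\<sigma> i"]) (auto simp: b g t_def)
      moreover have "\<beta> \<in> S"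
        using l(1) permutes_compose[OF t s] by (simp add: \<beta>_def sym_core_def)
      ultimately show ?thesis
        using closed by blast
    qed
  qed
  ultimately have "symmetric_strongly_shifted (ideal_of (sym_core S) :: ('n, 'k) mpoly set)"
    by (auto simp: symmetric_strongly_shifted_def monomial_ideal_ideal_of
        sym_fixed_ideal_of_sym_core partitions_of_def)
  then show ?thesis
    by (simp add: J symmetrization_ideal_of)
qed

lemma symmetric_strongly_shifted_exponents:
  assumes "symmetric_strongly_shifted I"
  shows "I = ideal_of (exponents I)" "up_closed (exponents I)" "0 \<notin> exponents I"
    "\<And>\<sigma> \<alpha>. \<sigma> permutes UNIV \<Longrightarrow> \<alpha> \<in> exponents I \<Longrightarrow> perm_exp \<sigma> \<alpha> \<in> exponents I"
proof -
  have I: "monomial_ideal I" "sym_fixed I"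
    using assms by (simp_all add: symmetric_strongly_shifted_def)
  show "I = ideal_of (exponents I)" "up_closed (exponents I)" "0 \<notin> exponents I"
    by (rule monomial_ideal_exponents[OF I(1)])+
  show "perm_exp \<sigma> \<alpha> \<in> exponents I" if "\<sigma> permutes UNIV" "\<alpha> \<in> exponents I" for \<sigma> \<alpha>
    by (rule perm_exp_exponents[OF I that])
qed

text \<open>The shift condition on partitions extends to all exponents by sorting.\<close>

lemma symmetric_strongly_shifted_shift:
  fixes I :: "('n::{finite,linorder}, 'k::field) mpoly set"
  assumes I: "symmetric_strongly_shifted I"
    and "\<alpha> \<in> exponents I" "lk \<alpha> i < lk \<alpha> j"
  shows "shift i j \<alpha> \<in> exponents I"
proof -
  note E = symmetric_strongly_shifted_exponents(4)[OF I]
  obtain \<sigma> where s: "\<sigma> permutes UNIV" "perm_exp \<sigma> \<alpha> \<in> partitions"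
    using ex_perm_exp_partition by blast
  define \<nu> where "\<nu> = perm_exp \<sigma> \<alpha>"
  have l: "lk \<nu> (\<sigma> k) = lk \<alpha> k" for k
    by (simp add: \<nu>_def lookup_perm_exp s)
  have less: "lk \<nu> (\<sigma> i) < lk \<nu> (\<sigma> j)"
    using assms(3) by (simp add: l)
  \<comment> \<open>Sorting supplies the order of positions that the shift condition demands: in a
    nondecreasing vector a strictly smaller entry stands earlier.\<close>
  moreover have "\<sigma> i < \<sigma> j"
  proof (rule ccontr)
    assume "\<not> \<sigma> i < \<sigma> j"
    then have "lk \<nu> (\<sigma> j) \<le> lk \<nu> (\<sigma> i)"
      using s(2) by (simp add: \<nu>_def partitions_def mono_def)
    then show False
      using less by simp
  qed
  moreover have "\<nu> \<in> partitions_of I"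
    using E[OF s(1) assms(2)] s(2) by (simp add: partitions_of_def \<nu>_def exponents_def)
  ultimately have "shift (\<sigma> i) (\<sigma> j) \<nu> \<in> exponents I"
    using I by (simp add: symmetric_strongly_shifted_def exponents_def)
  moreover have "perm_exp (inv \<sigma>) (shift (\<sigma> i) (\<sigma> j) \<nu>) = shift i j \<alpha>"
  proof (rule perm_exp_eqI[OF permutes_inv[OF s(1)]])
    fix k
    obtain m where "k = \<sigma> m"
      using s(1) by (metis permutes_surj surjD)
    then show "lk (shift i j \<alpha>) (inv \<sigma> k) = lk (shift (\<sigma> i) (\<sigma> j) \<nu>) k"
      using permutes_inverses(2)[OF s(1)] inj_eq[OF permutes_inj[OF s(1)]]
      by (simp add: lookup_shift l)
  qed
  ultimately show ?thesis
    using E[OF permutes_inv[OF s(1)]] by metis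
qed

text \<open>The intermediate \<beta> need not be sorted, but monotonicity of the target \<mu> makes
  its entry at i strictly smaller than its entry at j, so the shift condition for arbitrary
  exponents applies.\<close>

lemma symmetric_strongly_shifted_dom_le:
  fixes I :: "('n::{finite,linorder}, 'k::field) mpoly set"
  assumes I: "symmetric_strongly_shifted I"
    and "\<nu> \<in> exponents I" "dom_le \<nu> \<mu>" "\<mu> \<in> partitions"
  shows "\<mu> \<in> exponents I"
proof (rule dom_le_closure[OF symmetric_strongly_shifted_exponents(2)[OF I] assms(2,3)])
  fix \<beta> i j
  assume b: "\<beta> \<in> exponents I" "i < j" "lk \<beta> i < lk \<mu> i" "lk \<mu> j < lk \<beta> j"
  have "lk \<mu> i \<le> lk \<mu> j"
    using assms(4) b(2) by (simp add: partitions_def mono_def)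
  then show "shift i j \<beta> \<in> exponents I"
    using b by (intro symmetric_strongly_shifted_shift[OF I]) auto
qed

lemma Sss_partitions:
  assumes "B \<subseteq> partitions"
  shows "Sss B = (ideal_of (sym_core (dom_up B)) :: ('n::{finite,linorder}, 'k::field) mpoly set)"
proof
  show "Sss B \<subseteq> (ideal_of (sym_core (dom_up B)) :: ('n, 'k) mpoly set)"
  proof (cases "0 \<in> B")
    case True
    then have "sym_core (dom_up B) = UNIV"
      by (simp add: dom_up_eq_UNIV sym_core_def)
    then show ?thesis
      by simp
  next
    case False
    have "symmetric_strongly_shifted (ideal_of (sym_core (dom_up B)) :: ('n, 'k) mpoly set)"
      using symmetric_strongly_shifted_symmetrization[OF strongly_stable_ideal_of_dom_up[OF False]]
      by (simp add: symmetrization_ideal_of)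
    moreover have "mon ` B \<subseteq> (ideal_of (sym_core (dom_up B)) :: ('n, 'k) mpoly set)"
      using assms by (auto simp: partition_in_sym_core_dom_up dom_up_refl)
    ultimately show ?thesis
      unfolding Sss_def by (intro hull_minimal)
  qed
  show "(ideal_of (sym_core (dom_up B)) :: ('n, 'k) mpoly set) \<subseteq> Sss B"
    unfolding Sss_def hull_def
  proof (rule Inter_greatest, clarify)
    fix I :: "('n, 'k) mpoly set" and f :: "('n, 'k) mpoly"
    assume I: "symmetric_strongly_shifted I" "mon ` B \<subseteq> I"
      and f: "f \<in> ideal_of (sym_core (dom_up B))"
    note E = symmetric_strongly_shifted_exponents[OF I(1)]
    \<comment> \<open>Sort \<alpha>, use dominance closure on the sorted vector, and undo the
      sorting by symmetry of I.\<close>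
    have "\<alpha> \<in> exponents I" if a: "\<alpha> \<in> sym_core (dom_up B)" for \<alpha>
    proof -
      obtain \<sigma> where s: "\<sigma> permutes UNIV" "perm_exp \<sigma> \<alpha> \<in> partitions"
        using ex_perm_exp_partition by blast
      then have "perm_exp \<sigma> \<alpha> \<in> dom_up B"
        using a by (simp add: sym_core_def)
      then have "perm_exp \<sigma> \<alpha> \<in> exponents I"
        using symmetric_strongly_shifted_dom_le[OF I(1)] I(2) s(2)
        by (auto simp: dom_up_def exponents_def)
      then show ?thesis
        using E(4)[OF permutes_inv[OF s(1)]] perm_exp_inv(1)[OF s(1)] by metis
    qed
    then have "f \<in> ideal_of (exponents I)"
      using f ideal_of_mono by blast
    then show "f \<in> I"
      using E(1) by simp
  qed
qed

text \<open>The correspondence for an arbitrary set of partitions; for the partition Borel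
  generators of an ideal it becomes the second claim of the theorem.\<close>

corollary Sss_eq_symmetrization_Borel:
  assumes "B \<subseteq> partitions"
  shows "(Sss B :: ('n::{finite,linorder}, 'k::field) mpoly set) = symmetrization (Borel (mon ` B))"
  by (simp add: Sss_partitions[OF assms] Borel_mon_image symmetrization_ideal_of)

lemma Sss_partitions_of:
  fixes I :: "('n::{finite,linorder}, 'k::field) mpoly set"
  assumes I: "symmetric_strongly_shifted I"
  shows "Sss (partitions_of I) = I"
proof
  have sub: "partitions_of I \<subseteq> partitions"
    by (auto simp: partitions_of_def)
  note E = symmetric_strongly_shifted_exponents[OF I]
  show "Sss (partitions_of I) \<subseteq> I"
    unfolding Sss_def using I by (intro hull_minimal) (auto simp: partitions_of_def)
  have "exponents I \<subseteq> sym_core (dom_up (partitions_of I))"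
  proof
    fix \<alpha> assume a: "\<alpha> \<in> exponents I"
    obtain \<sigma> where s: "\<sigma> permutes UNIV" "perm_exp \<sigma> \<alpha> \<in> partitions"
      using ex_perm_exp_partition by blast
    then have "perm_exp \<sigma> \<alpha> \<in> partitions_of I"
      using E(4)[OF s(1) a] by (simp add: partitions_of_def exponents_def)
    then have "perm_exp \<sigma> \<alpha> \<in> sym_core (dom_up (partitions_of I))"
      using s(2) by (simp add: partition_in_sym_core_dom_up dom_up_refl)
    then show "\<alpha> \<in> sym_core (dom_up (partitions_of I))"
      using perm_exp_sym_core[OF _ permutes_inv[OF s(1)]] perm_exp_inv(1)[OF s(1)] by metis
  qed
  then show "I \<subseteq> Sss (partitions_of I)"
    using E(1) ideal_of_mono Sss_partitions[OF sub] by metis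
qed

section \<open>Generators as minimal elements\<close>

definition dom_min :: "('n::{finite,linorder} \<Rightarrow>\<^sub>0 nat) set \<Rightarrow> ('n \<Rightarrow>\<^sub>0 nat) set" where
  "dom_min A = {\<mu>\<in>A. \<forall>\<nu>\<in>A. dom_le \<nu> \<mu> \<longrightarrow> \<nu> = \<mu>}"

lemma dom_min_subset: "dom_min A \<subseteq> A"
  by (auto simp: dom_min_def)

text \<open>Descent along \<open>weight\<close> ends, so every element of A lies above a minimal
  one.\<close>

lemma dom_up_dom_min: "dom_up (dom_min A) = dom_up A"
proof
  show "dom_up (dom_min A) \<subseteq> dom_up A"
    using dom_min_subset by (auto simp: dom_up_def)
  have "\<alpha> \<in> dom_up (dom_min A)" if "\<alpha> \<in> A" for \<alpha>
    using that
  proof (induction "weight \<alpha>" arbitrary: \<alpha> rule: less_induct)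
    case less
    show ?case
    proof (cases "\<alpha> \<in> dom_min A")
      case True
      then show ?thesis
        by (rule dom_up_refl)
    next
      case False
      then obtain \<beta> where "\<beta> \<in> A" "dom_le \<beta> \<alpha>" "\<beta> \<noteq> \<alpha>"
        using less.prems by (auto simp: dom_min_def)
      then show ?thesis
        using less.hyps dom_le_weight dom_up_dom_le by blast
    qed
  qed
  then show "dom_up A \<subseteq> dom_up (dom_min A)"
    using dom_up_dom_le by (auto simp: dom_up_def[of A])
qed

text \<open>A minimal partition \<mu> of I dominates some \<nu> in any generating set B; that \<nu>
  is itself a partition of I, so minimality forces it to be \<mu>.\<close>

lemma partition_borel_generators_dom_min:
  fixes I :: "('n::{finite,linorder}, 'k::field) mpoly set"
  assumes I: "symmetric_strongly_shifted I"
  shows "partition_borel_generators I (dom_min (partitions_of I))"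
  unfolding partition_borel_generators_def
proof (intro conjI allI impI subsetI)
  let ?P = "partitions_of I"
  have P: "?P \<subseteq> partitions"
    by (auto simp: partitions_of_def)
  then show "\<mu> \<in> partitions" if "\<mu> \<in> dom_min ?P" for \<mu>
    using that dom_min_subset by blast
  then have "Sss (dom_min ?P) = (Sss ?P :: ('n, 'k) mpoly set)"
    by (simp add: Sss_partitions P subsetI dom_up_dom_min)
  then show "I = Sss (dom_min ?P)"
    using Sss_partitions_of[OF I] by simp
next
  fix B \<mu>
  assume B: "B \<subseteq> partitions \<and> I = Sss B" and m: "\<mu> \<in> dom_min (partitions_of I)"
  then have eq: "I = ideal_of (sym_core (dom_up B))"
    by (simp add: Sss_partitions)
  have "\<mu> \<in> partitions" "mon \<mu> \<in> I"
    using m by (auto simp: dom_min_def partitions_of_def)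
  then have "\<mu> \<in> dom_up B"
    by (simp add: eq partition_in_sym_core_dom_up)
  then obtain \<nu> where l: "\<nu> \<in> B" "dom_le \<nu> \<mu>"
    by (auto simp: dom_up_def)
  moreover have "\<nu> \<in> partitions"
    using B l(1) by blast
  ultimately have "\<nu> \<in> partitions_of I"
    unfolding partitions_of_def eq by (simp add: partition_in_sym_core_dom_up dom_up_refl)
  then show "\<mu> \<in> B"
    using l m by (auto simp: dom_min_def)
qed

lemma partition_borel_generators_unique:
  "partition_borel_generators I B \<Longrightarrow> partition_borel_generators I B' \<Longrightarrow> B = B'"
  unfolding partition_borel_generators_def by blast

lemma borel_generators_dom_min:
  "borel_generators (Borel (mon ` dom_min A) :: ('n::{finite,linorder}, 'k::field) mpoly set)
     (mon ` dom_min A)"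
  unfolding borel_generators_def
proof (intro conjI allI impI)
  fix M :: "('n, 'k) mpoly set"
  assume M: "M \<subseteq> range mon \<and> Borel (mon ` dom_min A) = Borel M"
  then obtain C where C: "M = mon ` C"
    by (auto simp: subset_image_iff)
  then have "(ideal_of (dom_up A) :: ('n, 'k) mpoly set) = ideal_of (dom_up C)"
    using M by (simp add: Borel_mon_image dom_up_dom_min)
  then have eq: "dom_up A = dom_up C"
    by (metis exponents_ideal_of)
  have "dom_min A \<subseteq> C"
  proof
    fix \<mu> assume m: "\<mu> \<in> dom_min A"
    then have "\<mu> \<in> dom_up C"
      using eq dom_up_refl dom_min_subset by blast
    then obtain \<nu> where l: "\<nu> \<in> C" "dom_le \<nu> \<mu>"
      by (auto simp: dom_up_def)
    \<comment> \<open>The element \<nu> of C need not belong to A, so minimality of \<mu> is applied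
      to some \<kappa> in A below \<nu>; then \<nu> lies between \<mu> and \<mu>, and antisymmetry
      identifies them.\<close>
    then have "\<nu> \<in> dom_up A"
      by (simp add: eq dom_up_refl)
    then obtain \<kappa> where n: "\<kappa> \<in> A" "dom_le \<kappa> \<nu>"
      by (auto simp: dom_up_def)
    then have "\<kappa> = \<mu>"
      using m l(2) dom_le_trans by (auto simp: dom_min_def)
    then show "\<mu> \<in> C"
      using l n dom_le_antisym by metis
  qed
  then show "mon ` dom_min A \<subseteq> M"
    using C by blast
qed auto

theorem theorem1:
  fixes I :: "('n::{finite,linorder}, 'k::field) mpoly set"
  assumes "proper_ideal I"
  shows "(symmetric_strongly_shifted I \<longleftrightarrow>
            (\<exists>J. strongly_stable J \<and> I = symmetrization J)) \<and>
         (symmetric_strongly_shifted I \<longrightarrow>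
            (\<exists>!B. partition_borel_generators I B) \<and>
            (\<forall>B. partition_borel_generators I B \<longrightarrow>
               (\<exists>!J :: ('n, 'k) mpoly set. strongly_stable J \<and> borel_generators J (mon ` B)) \<and>
               (\<forall>J. strongly_stable J \<and> borel_generators J (mon ` B) \<longrightarrow>
                  I = symmetrization J)))"
proof -
  let ?B = "dom_min (partitions_of I)"
  let ?J = "Borel (mon ` ?B) :: ('n, 'k) mpoly set"
  have gens: "partition_borel_generators I ?B" and stable: "strongly_stable ?J"
    and sym: "I = symmetrization ?J" if I: "symmetric_strongly_shifted I"
  proof -
    show gens: "partition_borel_generators I ?B"
      by (rule partition_borel_generators_dom_min[OF I])
    \<comment> \<open>Properness of I enters here: it keeps the Borel hull from being all of R,
      which is not strongly stable.\<close>
    have "0 \<notin> ?B"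
      using symmetric_strongly_shifted_exponents(3)[OF I]
      by (auto simp: dom_min_def partitions_of_def exponents_def)
    then show "strongly_stable ?J"
      by (simp add: Borel_mon_image strongly_stable_ideal_of_dom_up)
    show "I = symmetrization ?J"
      using gens Sss_eq_symmetrization_Borel[of ?B]
      by (auto simp: partition_borel_generators_def)
  qed
  \<comment> \<open>Uniqueness of J is immediate because having given Borel generators includes
    being their Borel hull.\<close>
  have only: "J = ?J" if "borel_generators J (mon ` ?B)" for J
    using that by (simp add: borel_generators_def)
  show ?thesis
  proof (intro conjI iffI impI allI)
    show "\<exists>J. strongly_stable J \<and> I = symmetrization J" if "symmetric_strongly_shifted I"
      using that stable sym by blast
    show "symmetric_strongly_shifted I" if "\<exists>J. strongly_stable J \<and> I = symmetrization J"
      using that symmetric_strongly_shifted_symmetrization by blast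
    show "\<exists>!B. partition_borel_generators I B" if "symmetric_strongly_shifted I"
      using gens[OF that] partition_borel_generators_unique by blast
  next
    fix B
    assume I: "symmetric_strongly_shifted I" and "partition_borel_generators I B"
    then have B: "B = ?B"
      using gens partition_borel_generators_unique by blast
    show "\<exists>!J :: ('n, 'k) mpoly set. strongly_stable J \<and> borel_generators J (mon ` B)"
      unfolding B using stable[OF I] borel_generators_dom_min only by blast
    show "I = symmetrization J"
      if "strongly_stable J \<and> borel_generators J (mon ` B)" for J :: "('n, 'k) mpoly set"
      using that sym[OF I] only unfolding B by blast
  qed
qed

end
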